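(* Let $(L,[\cdot,\cdot],\alpha)$ be a hom-Leibniz algebra over a field $\mathbb{K}$ and let the bilinear maps $\bigtriangledown_1,\bigtriangledown_2:L\times L\to L$ define an affine hom-Leibniz structure on it. Then $L$ (with the twisting map $\alpha$) is a hom-left symmetric dialgebra with $\vdash$ and $\dashv$ defined by $x\vdash y=\bigtriangledown_1(x,y)$ and $x\dashv y=\bigtriangledown_2(x,y)$.
   Context: A hom-Leibniz algebra $(L,[\cdot,\cdot],\alpha)$ is a vector space $L$ with a bilinear product $[\cdot,\cdot]$ and a linear map $\alpha:L\to L$ such that $[[x,y],\alpha(z)]=[[x,z],\alpha(y)]+[\alpha(x),[y,z]]$ for all $x,y,z\in L$. A pair of bilinear maps $\bigtriangledown_1,\bigtriangledown_2:L\times L\to L$ is an affine hom-Leibniz structure on $(L,[\cdot,\cdot],\alpha)$ if for all $x,y,z\in L$: $\bigtriangledown_2(x,y)-\bigtriangledown_1(y,x)=[x,y]$; $\bigtriangledown_1(\bigtriangledown_1(x,y),\alpha(z))=\bigtriangledown_1(\bigtriangledown_2(x,y),\alpha(z))$ and $\bigtriangledown_2(\alpha(x),\bigtriangledown_2(y,z))=\bigtriangledown_2(\alpha(x),\bigtriangledown_1(y,z))$; $\bigtriangledown_2(\alpha(x),\bigtriangledown_2(y,z))-\bigtriangledown_1(\alpha(y),\bigtriangledown_2(x,z))=\bigtriangledown_2([x,y],\alpha(z))$; $\bigtriangledown_1(\alpha(x),\bigtriangledown_1(y,z))-\bigtriangledown_1(\alpha(y),\bigtriangledown_1(x,z))=\bigtriangledown_1([x,y],\alpha(z))$.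 A hom-left symmetric dialgebra is a vector space $S$ with two bilinear products $\dashv,\vdash:S\otimes S\to S$ and a linear map $\alpha:S\to S$ such that for all $x,y,z\in S$: $\alpha(x)\dashv(y\dashv z)=\alpha(x)\dashv(y\vdash z)$; $(x\vdash y)\vdash\alpha(z)=(x\dashv y)\vdash\alpha(z)$; $\alpha(x)\dashv(y\dashv z)-(x\dashv y)\dashv\alpha(z)=\alpha(y)\vdash(x\dashv z)-(y\vdash x)\dashv\alpha(z)$; $\alpha(x)\vdash(y\vdash z)-(x\vdash y)\vdash\alpha(z)=\alpha(y)\vdash(x\vdash z)-(y\vdash x)\vdash\alpha(z)$. *)

theory Defs
  imports Complex_Main
begin

text \<open>The underlying vector space is a whole type, and the field is the type of scalars of
  \<open>scale\<close>. \<open>Vector_Spaces.linear\<close> is written qualified because plain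
  \<open>linear\<close> abbreviates its real-scalar instance.\<close>

definition bilinear_op ::
    "('k::field \<Rightarrow> 'v::ab_group_add \<Rightarrow> 'v) \<Rightarrow> ('v \<Rightarrow> 'v \<Rightarrow> 'v) \<Rightarrow> bool" where
  "bilinear_op scale f \<longleftrightarrow>
     (\<forall>x. Vector_Spaces.linear scale scale (\<lambda>y. f x y)) \<and>
     (\<forall>y. Vector_Spaces.linear scale scale (\<lambda>x. f x y))"

locale hom_leibniz_algebra = vector_space scale
  for scale :: "'k::field \<Rightarrow> 'v::ab_group_add \<Rightarrow> 'v" +
  fixes bracket :: "'v \<Rightarrow> 'v \<Rightarrow> 'v"
    and \<alpha> :: "'v \<Rightarrow> 'v"
  assumes bilinear_bracket: "bilinear_op scale bracket"
    and linear_twist: "Vector_Spaces.linear scale scale \<alpha>"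
    and hom_leibniz_identity:
      "bracket (bracket x y) (\<alpha> z) = bracket (bracket x z) (\<alpha> y) + bracket (\<alpha> x) (bracket y z)"

locale affine_hom_leibniz_structure = hom_leibniz_algebra scale bracket \<alpha>
  for scale :: "'k::field \<Rightarrow> 'v::ab_group_add \<Rightarrow> 'v"
    and bracket :: "'v \<Rightarrow> 'v \<Rightarrow> 'v"
    and \<alpha> :: "'v \<Rightarrow> 'v" +
  fixes nabla1 nabla2 :: "'v \<Rightarrow> 'v \<Rightarrow> 'v"
  assumes bilinear_nabla1: "bilinear_op scale nabla1"
    and bilinear_nabla2: "bilinear_op scale nabla2"
    and nabla_bracket: "nabla2 x y - nabla1 y x = bracket x y"
    and nabla1_left_eq: "nabla1 (nabla1 x y) (\<alpha> z) = nabla1 (nabla2 x y) (\<alpha> z)"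
    and nabla2_right_eq: "nabla2 (\<alpha> x) (nabla2 y z) = nabla2 (\<alpha> x) (nabla1 y z)"
    and nabla2_curvature:
      "nabla2 (\<alpha> x) (nabla2 y z) - nabla1 (\<alpha> y) (nabla2 x z) = nabla2 (bracket x y) (\<alpha> z)"
    and nabla1_curvature:
      "nabla1 (\<alpha> x) (nabla1 y z) - nabla1 (\<alpha> y) (nabla1 x z) = nabla1 (bracket x y) (\<alpha> z)"

locale hom_left_symmetric_dialgebra = vector_space scale
  for scale :: "'k::field \<Rightarrow> 'v::ab_group_add \<Rightarrow> 'v" +
  fixes dashv :: "'v \<Rightarrow> 'v \<Rightarrow> 'v" (infix \<open>\<stileturn>\<close> 70)
    and vdash :: "'v \<Rightarrow> 'v \<Rightarrow> 'v" (infix \<open>\<turnstile>\<close> 70)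
    and \<alpha> :: "'v \<Rightarrow> 'v"
  assumes bilinear_dashv: "bilinear_op scale (\<stileturn>)"
    and bilinear_vdash: "bilinear_op scale (\<turnstile>)"
    and linear_twist: "Vector_Spaces.linear scale scale \<alpha>"
    and dashv_right_eq: "\<alpha> x \<stileturn> (y \<stileturn> z) = \<alpha> x \<stileturn> (y \<turnstile> z)"
    and vdash_left_eq: "(x \<turnstile> y) \<turnstile> \<alpha> z = (x \<stileturn> y) \<turnstile> \<alpha> z"
    and dashv_left_symmetric:
      "\<alpha> x \<stileturn> (y \<stileturn> z) - (x \<stileturn> y) \<stileturn> \<alpha> z = \<alpha> y \<turnstile> (x \<stileturn> z) - (y \<turnstile> x) \<stileturn> \<alpha> z"
    and vdash_left_symmetric:
      "\<alpha> x \<turnstile> (y \<turnstile> z) - (x \<turnstile> y) \<turnstile> \<alpha> z = \<alpha> y \<turnstile> (x \<turnstile> z) - (y \<turnstile> x) \<turnstile> \<alpha> z"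

end

theory Submission
  imports Defs
begin

text \<open>Substituting \<open>nabla2 x y - nabla1 y x\<close> for the bracket in the two curvature identities and
  expanding by additivity in the left argument turns each right-hand side into a difference of two
  products, and moving these across leaves the two left-symmetry identities. For \<open>nabla2\<close> the
  terms already fit the dialgebra axiom; for \<open>nabla1\<close> the term
  \<open>nabla1 (nabla2 x y) (\<alpha> z)\<close> appears where the axiom has
  \<open>nabla1 (nabla1 x y) (\<alpha> z)\<close>, and the left compatibility of the two products identifies them.
  The remaining dialgebra axioms are axioms of the affine structure.\<close>

lemma bilinear_op_diff_left:
  assumes "bilinear_op scale f"
  shows "f (x - y) z = f x z - f y z"
proof -
  interpret Vector_Spaces.linear scale scale "\<lambda>x. f x z"
    using assms by (simp add: bilinear_op_def)
  show ?thesis by (rule diff)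
qed

theorem theorem4p21:
  fixes scale :: "'k::field \<Rightarrow> 'v::ab_group_add \<Rightarrow> 'v"
    and bracket :: "'v \<Rightarrow> 'v \<Rightarrow> 'v"
    and \<alpha> :: "'v \<Rightarrow> 'v"
    and nabla1 nabla2 :: "'v \<Rightarrow> 'v \<Rightarrow> 'v"
    and vdash dashv :: "'v \<Rightarrow> 'v \<Rightarrow> 'v"
  assumes "hom_leibniz_algebra scale bracket \<alpha>"
    and "affine_hom_leibniz_structure scale bracket \<alpha> nabla1 nabla2"
    and "\<And>x y. vdash x y = nabla1 x y"
    and "\<And>x y. dashv x y = nabla2 x y"
  shows "hom_left_symmetric_dialgebra scale dashv vdash \<alpha>"
proof -
  interpret affine_hom_leibniz_structure scale bracket \<alpha> nabla1 nabla2
    by (fact assms(2))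
  have products: "vdash = nabla1" "dashv = nabla2"
    by (simp_all add: fun_eq_iff assms(3,4))
  have left_symmetric2: "nabla2 (\<alpha> x) (nabla2 y z) - nabla2 (nabla2 x y) (\<alpha> z)
      = nabla1 (\<alpha> y) (nabla2 x z) - nabla2 (nabla1 y x) (\<alpha> z)" for x y z
    using nabla2_curvature[of x y z]
    by (simp add: nabla_bracket[symmetric] bilinear_op_diff_left[OF bilinear_nabla2] algebra_simps)
  have left_symmetric1: "nabla1 (\<alpha> x) (nabla1 y z) - nabla1 (nabla1 x y) (\<alpha> z)
      = nabla1 (\<alpha> y) (nabla1 x z) - nabla1 (nabla1 y x) (\<alpha> z)" for x y z
    using nabla1_curvature[of x y z]
    by (simp add: nabla_bracket[symmetric] bilinear_op_diff_left[OF bilinear_nabla1]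
        nabla1_left_eq[symmetric] algebra_simps)
  show ?thesis
    unfolding products
    by (intro hom_left_symmetric_dialgebra.intro hom_left_symmetric_dialgebra_axioms.intro)
      (fact vector_space_axioms bilinear_nabla1 bilinear_nabla2 linear_twist
        nabla1_left_eq nabla2_right_eq left_symmetric1 left_symmetric2)+
qed

end
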